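(* There is a deterministic algorithm which, given $A\in\mathbb R^{n\times d}$ and query access to $b\in\mathbb R^n$, reads $O(d\log\log d)$ entries of $b$ and outputs $\tilde x\in\mathbb R^d$ such that $$\|A\tilde x-b\|_\infty\le O(\sqrt d)\,\min_{x\in\mathbb R^d}\|Ax-b\|_\infty .$$
   Context: Active regression: the design matrix $A$ is fully known to the algorithm, while each entry of $b$ read counts as one query. $O(\cdot)$ hides absolute constants; $\log\log d$ is read as at least $1$. *)

theory Defs
  imports Complex_Main "Jordan_Normal_Form.Matrix"
begin

text \<open>A deterministic query algorithm is a decision tree. At \<open>Query i k\<close> it reads the entry with
  index \<open>i\<close> (counting from 0) and continues with \<open>k\<close> applied to the value read, so queries may be
  adaptive. The values read are its only access to the unknown vector. Being a datatype, such a tree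
  stops after finitely many queries on every input. Computation between queries is free.\<close>

datatype query_alg = Output "real vec" | Query nat "real \<Rightarrow> query_alg"

primrec run :: "query_alg \<Rightarrow> real vec \<Rightarrow> real vec" where
  "run (Output x) b = x"
| "run (Query i k) b = run (k (b $ i)) b"

text \<open>A repeated read of the same entry is listed, hence counted, again.\<close>

primrec reads :: "query_alg \<Rightarrow> real vec \<Rightarrow> nat list" where
  "reads (Output x) b = []"
| "reads (Query i k) b = i # reads (k (b $ i)) b"

text \<open>Inserting 0 only matters for the empty vector, whose norm is 0.\<close>

definition linf_norm :: "real vec \<Rightarrow> real" where
  "linf_norm v = Max (insert 0 {\<bar>v $ i\<bar> |i. i < dim_vec v})"

text \<open>The minimum over \<open>x\<close> exists (the column space is closed), so it equals this infimum.\<close>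

definition min_linf_residual :: "real mat \<Rightarrow> real vec \<Rightarrow> real" where
  "min_linf_residual A b = (INF x\<in>carrier_vec (dim_col A). linf_norm (A *\<^sub>v x - b))"

text \<open>Values below 1 are raised to 1; this covers \<open>d = 1\<close>, where \<open>ln (ln d) = ln 0 = 0\<close> by
  convention.\<close>

definition loglog :: "nat \<Rightarrow> real" where
  "loglog d = max 1 (ln (ln (real d)))"

end

theory Submission
  imports Defs "Jordan_Normal_Form.Determinant"
begin

text \<open>The algorithm is least squares on \<open>2 d\<close> rows, chosen with repetition so as to maximize the
  determinant of their Gram matrix \<open>M\<close> (a D-optimal exact design). This gives \<open>O(d)\<close> reads. Write
  \<open>h\<^sub>i\<^sub>j\<close> for the entries of \<open>A M\<^sup>-\<^sup>1 A\<^sup>T\<close>. Replacing a chosen row \<open>i\<close> by any row \<open>j\<close> multiplies the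
  determinant by \<open>(1 + h\<^sub>j\<^sub>j) (1 - h\<^sub>i\<^sub>i) + h\<^sub>i\<^sub>j\<^sup>2\<close>, so by optimality this factor is at most 1. The \<open>h\<^sub>i\<^sub>i\<close>
  of the chosen rows add up to the trace \<open>d\<close> of the identity, so one of them is at most \<open>1/2\<close>, and
  hence \<open>h\<^sub>j\<^sub>j \<le> 1\<close> for every row \<open>j\<close>. Now \<open>h\<^sub>j\<^sub>j\<close> is the sum of the squares of the coefficients with
  which least squares predicts entry \<open>j\<close> from the \<open>2 d\<close> values read, so their absolute sum is at
  most \<open>\<surd>(2 d)\<close>. Rank deficiency is removed first by factoring \<open>A\<close> through a maximal set of
  independent rows.\<close>

section \<open>Selecting rows with repetition\<close>

text \<open>Indices form a list, since an exact design may use the same row several times.\<close>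

definition select_rows :: "'a mat \<Rightarrow> nat list \<Rightarrow> 'a mat" where
  "select_rows A xs = mat (length xs) (dim_col A) (\<lambda>(i, j). A $$ (xs ! i, j))"

lemma select_rows_carrier [simp]:
  "A \<in> carrier_mat n d \<Longrightarrow> select_rows A xs \<in> carrier_mat (length xs) d"
  by (simp add: select_rows_def)

lemma dim_select_rows [simp]:
  "dim_row (select_rows A xs) = length xs" "dim_col (select_rows A xs) = dim_col A"
  by (simp_all add: select_rows_def)

lemma index_select_rows [simp]:
  "i < length xs \<Longrightarrow> j < dim_col A \<Longrightarrow> select_rows A xs $$ (i, j) = A $$ (xs ! i, j)"
  by (simp add: select_rows_def)

lemma row_select_rows [simp]:
  "i < length xs \<Longrightarrow> xs ! i < dim_row A \<Longrightarrow> row (select_rows A xs) i = row A (xs ! i)"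
  by (intro eq_vecI) auto

lemma select_rows_mult:
  assumes "set xs \<subseteq> {..<dim_row A}"
  shows "select_rows (A * B) xs = select_rows A xs * B"
proof (rule eq_matI)
  fix i j assume "i < dim_row (select_rows A xs * B)" "j < dim_col (select_rows A xs * B)"
  moreover from this have "xs ! i < dim_row A"
    using assms by (metis dim_select_rows(1) index_mult_mat(2) lessThan_iff nth_mem subsetD)
  ultimately show "select_rows (A * B) xs $$ (i, j) = (select_rows A xs * B) $$ (i, j)"
    by simp
qed auto

section \<open>Factorization through independent rows\<close>

lemma extend_right_inverse:
  fixes A :: "real mat"
  assumes A: "A \<in> carrier_mat n d" and xs: "set xs \<subseteq> {..<n}"
    and R: "R \<in> carrier_mat d (length xs)" and inv: "select_rows A xs * R = 1\<^sub>m (length xs)"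
    and i: "i < n" and ne: "row (A * (R * select_rows A xs)) i \<noteq> row A i"
  shows "\<exists>R' \<in> carrier_mat d (Suc (length xs)).
    select_rows A (xs @ [i]) * R' = 1\<^sub>m (Suc (length xs))"
proof -
  txt \<open>Row \<open>i\<close> minus its reproduction by the selected rows gives, after projection, a vector \<open>z\<close>
    orthogonal to the selected rows with \<open>row A i \<bullet> z = 1\<close>; it is the new column of the inverse.\<close>
  let ?r = "length xs" and ?T = "select_rows A xs"
  have T: "?T \<in> carrier_mat ?r d" using A by simp
  define w where "w = row A i - row (A * (R * ?T)) i"
  have rows: "row A i \<in> carrier_vec d" "row (A * (R * ?T)) i \<in> carrier_vec d"
    using A i R T by auto
  then have w: "w \<in> carrier_vec d" by (simp add: w_def)
  have "w \<noteq> 0\<^sub>v d"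
  proof
    assume "w = 0\<^sub>v d"
    then have "row A i $ l - row (A * (R * ?T)) i $ l = 0" if "l < d" for l
      using that rows unfolding w_def
      by (metis carrier_vecD index_minus_vec(1) index_zero_vec(1))
    then have "row (A * (R * ?T)) i = row A i" using rows A by (intro eq_vecI) auto
    with ne show False ..
  qed
  then have s: "w \<bullet> w \<noteq> 0"
    using conjugate_square_eq_0_vec[OF w] by simp
  define z where "z = (1 / (w \<bullet> w)) \<cdot>\<^sub>v (w - R *\<^sub>v (?T *\<^sub>v w))"
  have z: "z \<in> carrier_vec d" using w R T by (simp add: z_def)
  have Tz: "?T *\<^sub>v z = 0\<^sub>v ?r"
  proof -
    have "?T *\<^sub>v (R *\<^sub>v (?T *\<^sub>v w)) = (?T * R) *\<^sub>v (?T *\<^sub>v w)"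
      using assoc_mult_mat_vec[OF T R, of "?T *\<^sub>v w"] T w by simp
    also have "\<dots> = ?T *\<^sub>v w" using inv T w by simp
    moreover have "?T *\<^sub>v w - ?T *\<^sub>v w = 0\<^sub>v ?r" using T w by (intro minus_cancel_vec) simp
    ultimately show ?thesis using T R w
      by (simp add: z_def mult_mat_vec mult_minus_distrib_mat_vec) (intro eq_vecI; simp)
  qed
  have iz: "row A i \<bullet> z = 1"
  proof -
    \<comment> \<open>Row \<open>i\<close> times \<open>R *\<^sub>v (?T *\<^sub>v w)\<close> is the
      reproduced row times \<open>w\<close>, so subtracting it from row \<open>i\<close> times
      \<open>w\<close> leaves \<open>w \<bullet> w\<close>.\<close>
    have "A *\<^sub>v (R *\<^sub>v (?T *\<^sub>v w)) = (A * (R * ?T)) *\<^sub>v w"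
      using assoc_mult_mat_vec[OF A mult_carrier_mat[OF R T] w] assoc_mult_mat_vec[OF R T w] by simp
    then have "row A i \<bullet> (R *\<^sub>v (?T *\<^sub>v w)) = row (A * (R * ?T)) i \<bullet> w"
      using A i by (metis carrier_matD(1) index_mult_mat(2) index_mult_mat_vec)
    then have "row A i \<bullet> (w - R *\<^sub>v (?T *\<^sub>v w)) = w \<bullet> w"
      using rows w R T
      by (simp add: w_def scalar_prod_minus_distrib[of _ d] minus_scalar_prod_distrib[of _ d])
    then show ?thesis using rows w R T s by (simp add: z_def)
  qed
  \<comment> \<open>The old columns are corrected by multiples of \<open>z\<close> that cancel their
    products with row \<open>i\<close>. As \<open>z\<close> is orthogonal to the selected rows, the
    old identity block is unchanged.\<close>
  define R' where "R' = mat d (Suc ?r)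
    (\<lambda>(p, q). if q < ?r then R $$ (p, q) - (A * R) $$ (i, q) * z $ p else z $ p)"
  have col: "col R' q = (if q < ?r then col R q - (A * R) $$ (i, q) \<cdot>\<^sub>v z else z)"
    if "q < Suc ?r" for q
    using that z R by (intro eq_vecI) (auto simp: R'_def)
  have colR: "col R q \<in> carrier_vec d" for q using R by auto
  have old: "row A (xs ! p) \<bullet> z = 0" "q < ?r \<Longrightarrow> row A (xs ! p) \<bullet> col R q = 1\<^sub>m ?r $$ (p, q)"
    and rowp: "row A (xs ! p) \<in> carrier_vec d" "xs ! p < n"
    if p: "p < ?r" for p q
  proof -
    show n: "xs ! p < n" using xs p by (metis lessThan_iff nth_mem subsetD)
    show "row A (xs ! p) \<in> carrier_vec d" using A n by auto
    show "row A (xs ! p) \<bullet> z = 0" using Tz p n A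
      by (metis carrier_matD(1) index_mult_mat_vec index_zero_vec(1) row_select_rows dim_select_rows(1))
    show "row A (xs ! p) \<bullet> col R q = 1\<^sub>m ?r $$ (p, q)" if "q < ?r"
      using inv p n A R that
      by (metis carrier_matD(1) carrier_matD(2) index_mult_mat(1) row_select_rows dim_select_rows(1))
  qed
  have new: "(A * R) $$ (i, q) = row A i \<bullet> col R q" if "q < ?r" for q
    using A R i that by simp
  have "select_rows A (xs @ [i]) * R' = 1\<^sub>m (Suc ?r)"
  proof (rule eq_matI)
    fix p q assume "p < dim_row (1\<^sub>m (Suc ?r) :: real mat)" "q < dim_col (1\<^sub>m (Suc ?r) :: real mat)"
    then have pq: "p < Suc ?r" "q < Suc ?r" by auto
    have "(xs @ [i]) ! p < n" using rowp(2) i pq by (auto simp: nth_append)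
    then have "(select_rows A (xs @ [i]) * R') $$ (p, q) = row A ((xs @ [i]) ! p) \<bullet> col R' q"
      using pq A by (simp add: R'_def)
    also have "\<dots> = 1\<^sub>m (Suc ?r) $$ (p, q)"
    proof (cases "p < ?r")
      case True
      then show ?thesis using pq rowp[OF True] old[OF True] z colR
        by (auto simp: nth_append col scalar_prod_minus_distrib[of _ d])
    next
      case False
      then have "p = ?r" using pq by simp
      then show ?thesis using pq rows(1) iz new z colR
        by (auto simp: nth_append col scalar_prod_minus_distrib[of _ d])
    qed
    finally show "(select_rows A (xs @ [i]) * R') $$ (p, q) = 1\<^sub>m (Suc ?r) $$ (p, q)" .
  qed (auto simp: R'_def)
  then show ?thesis by (intro bexI[of _ R']) (auto simp: R'_def)
qed

text \<open>Independence of the selected rows is expressed by a right inverse \<open>R\<close>.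
  Sizes of such selections are bounded by \<open>d\<close>, so a largest one exists. It reproduces
  every row, because a row not reproduced could be appended by
  \<open>extend_right_inverse\<close>.\<close>

lemma row_factorization:
  fixes A :: "real mat"
  assumes A: "A \<in> carrier_mat n d"
  obtains xs R where "length xs \<le> d" "set xs \<subseteq> {..<n}" "R \<in> carrier_mat d (length xs)"
    "select_rows A xs * R = 1\<^sub>m (length xs)" "A * (R * select_rows A xs) = A"
proof -
  define P where "P r \<longleftrightarrow> r \<le> d \<and> (\<exists>xs R. length xs = r \<and> set xs \<subseteq> {..<n} \<and>
    R \<in> carrier_mat d r \<and> select_rows A xs * R = 1\<^sub>m r)" for r
  have "P 0" using A by (auto simp: P_def intro!: exI[of _ "[]"] exI[of _ "0\<^sub>m d 0"] eq_matI)
  moreover have bound: "\<And>r. P r \<Longrightarrow> r \<le> d" by (simp add: P_def)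
  ultimately obtain g where "P g" and max: "\<And>r. P r \<Longrightarrow> r \<le> g"
    by (metis GreatestI_nat Greatest_le_nat)
  then obtain xs R where le: "length xs \<le> d" and xs: "set xs \<subseteq> {..<n}"
    and R: "R \<in> carrier_mat d (length xs)" and inv: "select_rows A xs * R = 1\<^sub>m (length xs)"
    and len: "length xs = g"
    unfolding P_def by blast
  have T: "select_rows A xs \<in> carrier_mat (length xs) d" using A by simp
  have "A * (R * select_rows A xs) = A"
  \<comment> \<open>At size \<open>d\<close> the right inverse of a square matrix is also a left
    inverse. Below \<open>d\<close> an appended row still respects the bound built into
    \<open>P\<close>, so maximality applies.\<close>
  proof (cases "length xs = d")
    case True
    then have "R * select_rows A xs = 1\<^sub>m d"
      using mat_mult_left_right_inverse[of "select_rows A xs" d R] T R inv by simp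
    then show ?thesis using A by simp
  next
    case False
    have "row (A * (R * select_rows A xs)) i = row A i" if "i < n" for i
    proof (rule ccontr)
      assume "row (A * (R * select_rows A xs)) i \<noteq> row A i"
      from extend_right_inverse[OF A xs R inv that this] obtain R'
        where "R' \<in> carrier_mat d (Suc (length xs))"
          "select_rows A (xs @ [i]) * R' = 1\<^sub>m (Suc (length xs))" by blast
      moreover have "Suc (length xs) \<le> d" "length (xs @ [i]) = Suc (length xs)"
        "set (xs @ [i]) \<subseteq> {..<n}" using False le xs that by auto
      ultimately have "P (Suc (length xs))" unfolding P_def by blast
      then show False using max len by fastforce
    qed
    then show ?thesis using A T by (intro eq_rowI) auto
  qed
  with le xs R inv show thesis by (rule that)
qed

section \<open>Determinants of Gram matrices\<close>

lemma det_2x2: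
  fixes A :: "'a :: idom mat"
  assumes A: "A \<in> carrier_mat 2 2"
  shows "det A = A $$ (0, 0) * A $$ (1, 1) - A $$ (0, 1) * A $$ (1, 0)"
proof -
  have "det A = (\<Sum>j<2. A $$ (0, j) * cofactor A 0 j)"
    using laplace_expansion_row[OF A, of 0] by simp
  then show ?thesis using A
    by (simp add: numeral_2_eq_2 cofactor_def det_single mat_delete_def)
qed

text \<open>Sylvester's identity. The block matrix \<open>?F\<close> factors both as
  \<open>?L * ?P\<close> and as \<open>?Q * ?L\<close>. All factors are block triangular and
  \<open>?L\<close> has determinant 1, so the other two determinants agree.\<close>

lemma det_one_add_mult_commute:
  fixes U V :: "'a :: idom mat"
  assumes U: "U \<in> carrier_mat n m" and V: "V \<in> carrier_mat m n"
  shows "det (1\<^sub>m n + U * V) = det (1\<^sub>m m + V * U)"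
proof -
  let ?F = "four_block_mat (1\<^sub>m n) (- U) V (1\<^sub>m m)"
  let ?L = "four_block_mat (1\<^sub>m n) (0\<^sub>m n m) V (1\<^sub>m m)"
  let ?P = "four_block_mat (1\<^sub>m n) (- U) (0\<^sub>m m n) (1\<^sub>m m + V * U)"
  let ?Q = "four_block_mat (1\<^sub>m n + U * V) (- U) (0\<^sub>m m n) (1\<^sub>m m)"
  have UV: "U * V \<in> carrier_mat n n" "V * U \<in> carrier_mat m m" using U V by auto
  have L: "?L \<in> carrier_mat (n + m) (n + m)" and P: "?P \<in> carrier_mat (n + m) (n + m)"
    and Q: "?Q \<in> carrier_mat (n + m) (n + m)"
    using UV by (auto intro!: four_block_carrier_mat)
  have "- (V * U) + (1\<^sub>m m + V * U) = 1\<^sub>m m" using U V by (intro eq_matI) auto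
  then have LP: "?L * ?P = ?F"
    using U V UV by (subst mult_four_block_mat[of _ n n _ m _ m _ _ n _ m]) auto
  have "1\<^sub>m n + U * V + - (U * V) = 1\<^sub>m n" using U V by (intro eq_matI) auto
  then have QL: "?Q * ?L = ?F"
    using U V UV by (subst mult_four_block_mat[of _ n n _ m _ m _ _ n _ m]) auto
  have detL: "det ?L = 1"
    using V by (subst det_four_block_mat_upper_right_zero[of _ n _ m]) auto
  have detP: "det ?P = det (1\<^sub>m m + V * U)"
    using U UV by (subst det_four_block_mat_lower_left_zero[of _ n _ m]) auto
  have detQ: "det ?Q = det (1\<^sub>m n + U * V)"
    using U UV by (subst det_four_block_mat_lower_left_zero[of _ n _ m]) auto
  show ?thesis
    using det_mult[OF L P] det_mult[OF Q L] detL detP detQ LP QL by simp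
qed

definition gram :: "'a :: semiring_0 mat \<Rightarrow> nat list \<Rightarrow> 'a mat" where
  "gram A xs = (select_rows A xs)\<^sup>T * select_rows A xs"

lemma gram_carrier [simp]: "A \<in> carrier_mat n d \<Longrightarrow> gram A xs \<in> carrier_mat d d"
  by (auto simp: gram_def)

lemma index_gram:
  "i < dim_col A \<Longrightarrow> j < dim_col A \<Longrightarrow>
    gram A xs $$ (i, j) = (\<Sum>k<length xs. A $$ (xs ! k, i) * A $$ (xs ! k, j))"
  by (simp add: gram_def scalar_prod_def atLeast0LessThan)

lemma index_mult_mult_transpose:
  assumes "A \<in> carrier_mat m d" "N \<in> carrier_mat d d" "B \<in> carrier_mat k d" "i < m" "j < k"
  shows "(A * N * B\<^sup>T) $$ (i, j) = row A i \<bullet> (N *\<^sub>v row B j)"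
proof -
  have "A * N * B\<^sup>T = A * (N * B\<^sup>T)" using assms by (intro assoc_mult_mat) auto
  moreover have "col (N * B\<^sup>T) j = N *\<^sub>v row B j" using assms by (subst col_mult2) auto
  ultimately show ?thesis using assms by simp
qed

text \<open>The exchange adds the outer product of row \<open>j\<close> and removes that of the old
  row, a change \<open>U * V\<close> of rank at most two. Factoring out the Gram matrix and applying
  Sylvester's identity leaves a 2 by 2 determinant in the entries of \<open>G\<close>.\<close>

lemma det_gram_exchange:
  fixes C :: "real mat"
  assumes C: "C \<in> carrier_mat n r" and p: "p < length xs" and q: "xs ! p < n" and j: "j < n"
    and N: "N \<in> carrier_mat r r" and MN: "gram C xs * N = 1\<^sub>m r"
  defines "G \<equiv> C * N * C\<^sup>T"
  shows "det (gram C (xs[p := j])) = det (gram C xs) *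
    ((1 + G $$ (j, j)) * (1 - G $$ (xs ! p, xs ! p)) + G $$ (j, xs ! p) * G $$ (xs ! p, j))"
proof -
  let ?q = "xs ! p" and ?M = "gram C xs"
  define V where "V = select_rows C [j, ?q]"
  \<comment> \<open>The sign of the removed row sits in the second column of \<open>U\<close>, so
    \<open>V\<close> is a plain row selection.\<close>
  define U where "U = mat r 2 (\<lambda>(a, c). if c = 0 then C $$ (j, a) else - C $$ (?q, a))"
  have V: "V \<in> carrier_mat 2 r" and U: "U \<in> carrier_mat r 2" and M: "?M \<in> carrier_mat r r"
    using C by (auto simp: V_def U_def numeral_2_eq_2 select_rows_def)
  have NU: "N * U \<in> carrier_mat r 2" using N U by simp
  have upd: "gram C (xs[p := j]) = ?M + U * V"
  proof (rule eq_matI)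
    fix a b assume "a < dim_row (?M + U * V)" "b < dim_col (?M + U * V)"
    then have ab: "a < r" "b < r" using U V by auto
    let ?f = "\<lambda>i. C $$ (i, a) * C $$ (i, b)"
    \<comment> \<open>Only position \<open>p\<close> changes, so its term is split off; other
      occurrences of the same row in \<open>xs\<close> stay.\<close>
    have "(\<Sum>k<length xs. ?f (xs[p := j] ! k)) = ?f j + (\<Sum>k\<in>{..<length xs} - {p}. ?f (xs ! k))"
      using p by (subst sum.remove[of _ p]) auto
    moreover have "(\<Sum>k<length xs. ?f (xs ! k)) = ?f ?q + (\<Sum>k\<in>{..<length xs} - {p}. ?f (xs ! k))"
      using p by (subst sum.remove[of _ p]) auto
    moreover have "(U * V) $$ (a, b) = ?f j - ?f ?q"
      using ab U V C by (simp add: scalar_prod_def U_def V_def numeral_2_eq_2)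
    ultimately show "gram C (xs[p := j]) $$ (a, b) = (?M + U * V) $$ (a, b)"
      using ab U V C M by (simp add: index_gram)
  qed (use U V C in \<open>auto simp: gram_def\<close>)
  have "?M * (N * U * V) = ?M * N * U * V"
    using M N U V by (simp add: assoc_mult_mat[of _ r r _ r _ r] assoc_mult_mat[of _ r r _ 2 _ r]
        assoc_mult_mat[of _ r r _ r _ 2])
  then have "?M + U * V = ?M * (1\<^sub>m r + N * U * V)"
    using M N U V MN by (simp add: mult_add_distrib_mat[of _ r r _ r])
  then have "det (gram C (xs[p := j])) = det ?M * det (1\<^sub>m 2 + V * (N * U))"
    using upd det_mult[OF M, of "1\<^sub>m r + N * U * V"] det_one_add_mult_commute[OF NU V] NU V by simp
  moreover have "det (1\<^sub>m 2 + V * (N * U)) =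
      (1 + G $$ (j, j)) * (1 - G $$ (?q, ?q)) + G $$ (j, ?q) * G $$ (?q, j)"
  proof -
    have rows: "row C j \<in> carrier_vec r" "row C ?q \<in> carrier_vec r" using C j q by auto
    have cols: "col U 0 = row C j" "col U 1 = - row C ?q"
      using C j q by (auto simp: U_def intro!: eq_vecI)
    have rowV: "row V 0 = row C j" "row V 1 = row C ?q" using C j q by (auto simp: V_def)
    have neg: "N *\<^sub>v (- row C ?q) = - (N *\<^sub>v row C ?q)"
      using rows N C by (intro eq_vecI) (auto simp: scalar_prod_def sum_negf)
    have E: "(V * (N * U)) $$ (c, c') = row V c \<bullet> (N *\<^sub>v col U c')" if "c < 2" "c' < 2" for c c'
    proof -
      have "(V * (N * U)) $$ (c, c') = row V c \<bullet> col (N * U) c'" using that N U V by simp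
      then show ?thesis using col_mult2[OF N U that(2)] by simp
    qed
    have GE: "G $$ (a, b) = row C a \<bullet> (N *\<^sub>v row C b)" if "a < n" "b < n" for a b
      unfolding G_def by (rule index_mult_mult_transpose[OF C N C that])
    have un: "row C a \<bullet> (- (N *\<^sub>v row C ?q)) = - (row C a \<bullet> (N *\<^sub>v row C ?q))" if "a < n" for a
      using N C that by simp
    have two: "0 < (2 :: nat)" "1 < (2 :: nat)" by simp_all
    have ent: "(V * (N * U)) $$ (0, 0) = G $$ (j, j)" "(V * (N * U)) $$ (0, 1) = - G $$ (j, ?q)"
      "(V * (N * U)) $$ (1, 0) = G $$ (?q, j)" "(V * (N * U)) $$ (1, 1) = - G $$ (?q, ?q)"
      unfolding E[OF two(1) two(1)] E[OF two] E[OF two(2) two(1)] E[OF two(2) two(2)] cols rowV neg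
        un[OF j] un[OF q] GE[OF j j] GE[OF j q] GE[OF q j] GE[OF q q] by (rule refl)+
    have W: "1\<^sub>m 2 + V * (N * U) \<in> carrier_mat 2 2" using V NU by auto
    have "(1\<^sub>m 2 + V * (N * U)) $$ (0, 0) = 1 + G $$ (j, j)"
      "(1\<^sub>m 2 + V * (N * U)) $$ (0, 1) = - G $$ (j, ?q)"
      "(1\<^sub>m 2 + V * (N * U)) $$ (1, 0) = G $$ (?q, j)"
      "(1\<^sub>m 2 + V * (N * U)) $$ (1, 1) = 1 - G $$ (?q, ?q)"
      using V N U by (simp_all add: ent del: index_mult_mat(1) One_nat_def)
    then show ?thesis unfolding det_2x2[OF W] by simp
  qed
  ultimately show ?thesis by simp
qed

text \<open>Cyclicity of the trace for rectangular factors; it evaluates the sum of the leverages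
  (diagonal entries of \<open>G\<close>) over the chosen rows.\<close>

lemma sum_diag_mult_commute:
  fixes A B :: "'a :: comm_semiring_0 mat"
  assumes "A \<in> carrier_mat m n" "B \<in> carrier_mat n m"
  shows "(\<Sum>i<m. (A * B) $$ (i, i)) = (\<Sum>i<n. (B * A) $$ (i, i))"
proof -
  have "(\<Sum>i<m. (A * B) $$ (i, i)) = (\<Sum>i<m. \<Sum>j<n. A $$ (i, j) * B $$ (j, i))"
    using assms by (simp add: scalar_prod_def atLeast0LessThan)
  also have "\<dots> = (\<Sum>j<n. \<Sum>i<m. B $$ (j, i) * A $$ (i, j))"
    by (subst sum.swap) (simp add: mult.commute)
  also have "\<dots> = (\<Sum>i<n. (B * A) $$ (i, i))"
    using assms by (simp add: scalar_prod_def atLeast0LessThan)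
  finally show ?thesis .
qed

lemma obtain_inverse:
  fixes M :: "'a :: field mat"
  assumes M: "M \<in> carrier_mat n n" and "det M \<noteq> 0"
  obtains N where "N \<in> carrier_mat n n" "M * N = 1\<^sub>m n" "N * M = 1\<^sub>m n"
proof -
  from det_non_zero_imp_unit[OF assms, of "()"] obtain N
    where "N \<in> carrier_mat n n" "N * M = 1\<^sub>m n"
    by (auto simp: Units_def ring_mat_def)
  with mat_mult_left_right_inverse[OF _ M] that show thesis by blast
qed

lemma inverse_symmetric:
  fixes M :: "'a :: field mat"
  assumes M: "M \<in> carrier_mat n n" and N: "N \<in> carrier_mat n n"
    and inv: "M * N = 1\<^sub>m n" and sym: "M\<^sup>T = M"
  shows "N\<^sup>T = N"
proof -
  have "N\<^sup>T * M = 1\<^sub>m n" using transpose_mult[OF M N] inv sym by simp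
  then have "N\<^sup>T * M * N = N" using N by simp
  then show ?thesis using assoc_mult_mat[of "N\<^sup>T" n n M n N n] M N inv by simp
qed

text \<open>If the Gram matrix maps \<open>v\<close> to 0, then pairing with \<open>v\<close> shows
  that the selected rows map \<open>v\<close> to a vector of norm 0.\<close>

lemma det_gram_nonzero:
  fixes C :: "real mat"
  assumes C: "C \<in> carrier_mat n r" and inj: "\<And>v. v \<in> carrier_vec r \<Longrightarrow>
    select_rows C xs *\<^sub>v v = 0\<^sub>v (length xs) \<Longrightarrow> v = 0\<^sub>v r"
  shows "det (gram C xs) \<noteq> 0"
proof
  let ?S = "select_rows C xs"
  have S: "?S \<in> carrier_mat (length xs) r" using C by simp
  assume "det (gram C xs) = 0"
  then obtain v where v: "v \<in> carrier_vec r" "v \<noteq> 0\<^sub>v r" and z: "gram C xs *\<^sub>v v = 0\<^sub>v r"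
    using det_0_iff_vec_prod_zero_field[OF gram_carrier[OF C]] by blast
  have Sv: "?S *\<^sub>v v \<in> carrier_vec (length xs)" using S v by simp
  have "?S\<^sup>T *\<^sub>v (?S *\<^sub>v v) = 0\<^sub>v r"
    using z S v assoc_mult_mat_vec[of "?S\<^sup>T" r "length xs" ?S r v] by (simp add: gram_def)
  then have "v \<bullet> (?S\<^sup>T *\<^sub>v (?S *\<^sub>v v)) = 0" using v by simp
  then have "(?S *\<^sub>v v) \<bullet> (?S *\<^sub>v v) = 0"
    using transpose_vec_mult_scalar[OF S v(1) Sv] comm_scalar_prod S v Sv
    by (metis mult_mat_vec_carrier transpose_carrier_mat)
  then have "?S *\<^sub>v v = 0\<^sub>v (length xs)"
    using conjugate_square_eq_0_vec[OF Sv] by simp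
  from inj[OF v(1) this] v(2) show False by simp
qed

section \<open>D-optimal designs and their leverages\<close>

text \<open>The rows \<open>ys\<close> supply one design with nonzero determinant, so an optimal
  design is nonsingular as well. The length \<open>2 * r \<le> k\<close> keeps the average leverage
  of the chosen rows at most 1/2.\<close>

lemma optimal_design:
  fixes C :: "real mat"
  assumes C: "C \<in> carrier_mat n r" and ys: "set ys \<subseteq> {..<n}"
    and id: "select_rows C ys = 1\<^sub>m (length ys)"
    and n: "0 < n" and k: "0 < k" "2 * r \<le> k"
  obtains xs N where "length xs = k" "set xs \<subseteq> {..<n}" "N \<in> carrier_mat r r"
    "gram C xs * N = 1\<^sub>m r" "N * gram C xs = 1\<^sub>m r" "N\<^sup>T = N"
    "\<And>j. j < n \<Longrightarrow> (C * N * C\<^sup>T) $$ (j, j) \<le> 1"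
proof -
  \<comment> \<open>Maximizing the absolute value spares a proof that Gram determinants are
    nonnegative.\<close>
  let ?X = "{xs. set xs \<subseteq> {..<n} \<and> length xs = k}" and ?f = "\<lambda>xs. \<bar>det (gram C xs)\<bar>"
  have r: "length ys = r"
    using arg_cong[OF id, of dim_col] C by simp
  \<comment> \<open>Padding to length \<open>k\<close> repeats row 0, an arbitrary row that exists
    by \<open>0 < n\<close>; the first \<open>r\<close> rows already determine
    \<open>v\<close>.\<close>
  define ys' where "ys' = ys @ replicate (k - r) 0"
  have ys': "ys' \<in> ?X" using ys n k r by (auto simp: ys'_def)
  have fin: "finite ?X" by (rule finite_lists_length_eq) simp
  have "det (gram C ys') \<noteq> 0"
  proof (rule det_gram_nonzero[OF C])
    fix v :: "real vec"
    assume v: "v \<in> carrier_vec r" and z: "select_rows C ys' *\<^sub>v v = 0\<^sub>v (length ys')"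
    show "v = 0\<^sub>v r"
    proof (rule eq_vecI)
      fix i assume "i < dim_vec (0\<^sub>v r :: real vec)"
      then have i: "i < r" by simp
      have y: "ys ! i < n" using i r ys by (metis lessThan_iff nth_mem subsetD)
      have "row C (ys ! i) = row (select_rows C ys) i" using i r y C by simp
      then have "row C (ys ! i) = unit_vec r i" using id i r by simp
      moreover have "(select_rows C ys' *\<^sub>v v) $ i = row C (ys ! i) \<bullet> v"
        using i r y C by (simp add: ys'_def nth_append)
      ultimately have "(select_rows C ys' *\<^sub>v v) $ i = v $ i" using v i by simp
      then show "v $ i = 0\<^sub>v r $ i" using i r by (simp only: z) (simp add: ys'_def)
    qed (use v in simp)
  qed
  define m where "m = Max (?f ` ?X)"
  have "m \<in> ?f ` ?X" unfolding m_def using fin ys' by (intro Max_in) auto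
  then obtain xs where xs: "xs \<in> ?X" and m: "m = ?f xs" by blast
  have max: "?f zs \<le> ?f xs" if "zs \<in> ?X" for zs
  proof -
    have "?f zs \<le> m" unfolding m_def using fin that by (intro Max_ge) auto
    then show ?thesis using m by simp
  qed
  have M: "gram C xs \<in> carrier_mat r r" using C by simp
  have det: "det (gram C xs) \<noteq> 0"
    using max[OF ys'] \<open>det (gram C ys') \<noteq> 0\<close> by auto
  obtain N where N: "N \<in> carrier_mat r r" and MN: "gram C xs * N = 1\<^sub>m r"
    and NM: "N * gram C xs = 1\<^sub>m r"
    using obtain_inverse[OF M det] .
  have "(gram C xs)\<^sup>T = gram C xs" 
    unfolding gram_def using C by (subst transpose_mult[of _ r "length xs" _ r]) auto
  then have sym: "N\<^sup>T = N" by (rule inverse_symmetric[OF M N MN])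
  define G where "G = C * N * C\<^sup>T"
  have len: "length xs = k" using xs by simp
  have lt: "xs ! p < n" if "p < k" for p
    using xs that by (metis (mono_tags, lifting) lessThan_iff mem_Collect_eq nth_mem subsetD)
  have Gsym: "G $$ (i, j) = G $$ (j, i)" if "i < n" "j < n" for i j
  proof -
    have "G\<^sup>T = G" using C N sym transpose_mult[of "C * N" n r "C\<^sup>T" n] transpose_mult[OF C N]
        assoc_mult_mat[of C n r N r "C\<^sup>T" n] by (simp add: G_def)
    then show ?thesis using that C N
      by (metis G_def carrier_matD index_mult_mat(2,3) index_transpose_mat(1,3))
  qed
  have exch: "(1 + G $$ (j, j)) * (1 - G $$ (xs ! p, xs ! p)) \<le> 1" if j: "j < n" and p: "p < k" for j p
  proof -
    let ?t = "(1 + G $$ (j, j)) * (1 - G $$ (xs ! p, xs ! p)) + G $$ (j, xs ! p) * G $$ (xs ! p, j)"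
    have "xs[p := j] \<in> ?X" using xs j by (auto dest!: subsetD[OF set_update_subset_insert])
    from max[OF this] have "\<bar>det (gram C xs)\<bar> * \<bar>?t\<bar> \<le> \<bar>det (gram C xs)\<bar>"
      using det_gram_exchange[OF C _ lt[OF p] j N MN] p len
      by (simp add: G_def abs_mult)
    then have "\<bar>?t\<bar> \<le> 1" using det by simp
    moreover have "0 \<le> G $$ (j, xs ! p) * G $$ (xs ! p, j)"
      using Gsym[OF j lt[OF p]] by simp
    ultimately show ?thesis by linarith
  qed
  let ?S = "select_rows C xs"
  have S: "?S \<in> carrier_mat k r" using C len select_rows_carrier by metis
  \<comment> \<open>The leverages of the chosen rows are the diagonal of
    \<open>?S * N * ?S\<^sup>T\<close>. By cyclicity their sum is the trace of
    \<open>N * gram C xs\<close>, the identity of size \<open>r\<close>.\<close>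
  have "(\<Sum>p<k. G $$ (xs ! p, xs ! p)) = (\<Sum>p<k. (?S * (N * ?S\<^sup>T)) $$ (p, p))"
  proof (rule sum.cong)
    fix p assume "p \<in> {..<k}"
    then have p: "p < k" by simp
    have "(?S * (N * ?S\<^sup>T)) $$ (p, p) = (?S * N * ?S\<^sup>T) $$ (p, p)"
      using S N by (simp add: assoc_mult_mat[of _ k r _ r _ k])
    also have "\<dots> = row ?S p \<bullet> (N *\<^sub>v row ?S p)"
      by (rule index_mult_mult_transpose[OF S N S p p])
    also have "row ?S p = row C (xs ! p)" using p lt[OF p] len C by simp
    also have "row C (xs ! p) \<bullet> (N *\<^sub>v row C (xs ! p)) = G $$ (xs ! p, xs ! p)"
      unfolding G_def by (rule index_mult_mult_transpose[OF C N C lt[OF p] lt[OF p], symmetric])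
    finally show "G $$ (xs ! p, xs ! p) = (?S * (N * ?S\<^sup>T)) $$ (p, p)" by (rule HOL.sym)
  qed simp
  also have "\<dots> = (\<Sum>p<r. (N * ?S\<^sup>T * ?S) $$ (p, p))"
    using S N by (intro sum_diag_mult_commute) auto
  also have "N * ?S\<^sup>T * ?S = 1\<^sub>m r"
    using assoc_mult_mat[of N r r "?S\<^sup>T" k ?S r] S N NM by (simp add: gram_def)
  finally have trace: "(\<Sum>p<k. G $$ (xs ! p, xs ! p)) = real r" by simp
  \<comment> \<open>If all of them exceeded 1/2, their sum would exceed \<open>k / 2\<close>, hence
    \<open>r\<close>. Strictness rests on \<open>0 < k\<close>, also when
    \<open>r = 0\<close>.\<close>
  obtain p where p: "p < k" "G $$ (xs ! p, xs ! p) \<le> 1 / 2"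
  proof (rule ccontr)
    assume "\<not> thesis"
    then have "(\<Sum>p<k. 1 / 2) < (\<Sum>p<k. G $$ (xs ! p, xs ! p))"
      using that k(1) by (intro sum_strict_mono) force+
    then show False using trace k by simp
  qed
  have "G $$ (j, j) \<le> 1" if "j < n" for j
  proof (rule ccontr)
    assume "\<not> G $$ (j, j) \<le> 1"
    \<comment> \<open>The first factor exceeds 2 and the second is at least 1/2.\<close>
    then have "2 * (1 / 2) < (1 + G $$ (j, j)) * (1 - G $$ (xs ! p, xs ! p))"
      using p by (intro mult_less_le_imp_less) auto
    with exch[OF that p(1)] show False by simp
  qed
  with xs len N MN NM sym show thesis using that by (simp add: G_def)
qed

text \<open>\<open>L\<close> computes a least squares solution from the values read, and
  \<open>H\<close> its prediction of all entries. The equation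
  \<open>H * select_rows A xs = A\<close> says that the column space of \<open>A\<close> is
  predicted exactly. The squared norm of row \<open>j\<close> of \<open>H\<close> is the leverage of
  \<open>j\<close>.\<close>

lemma design_reconstruction:
  fixes A :: "real mat"
  assumes A: "A \<in> carrier_mat n d" and n: "0 < n" and d: "0 < d"
  obtains xs H L where "length xs = 2 * d" "set xs \<subseteq> {..<n}"
    "H \<in> carrier_mat n (2 * d)" "L \<in> carrier_mat d (2 * d)"
    "A * L = H" "H * select_rows A xs = A"
    "\<And>j. j < n \<Longrightarrow> (\<Sum>i<2 * d. (H $$ (j, i))\<^sup>2) \<le> 1"
proof -
  obtain ys R where ys: "length ys \<le> d" "set ys \<subseteq> {..<n}" and R: "R \<in> carrier_mat d (length ys)"
    and inv: "select_rows A ys * R = 1\<^sub>m (length ys)" and fac: "A * (R * select_rows A ys) = A"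
    using row_factorization[OF A] .
  let ?r = "length ys" and ?k = "2 * d" and ?T = "select_rows A ys" and ?C = "A * R"
  have C: "?C \<in> carrier_mat n ?r" and T: "?T \<in> carrier_mat ?r d" using A R by auto
  have "select_rows ?C ys = 1\<^sub>m ?r" using select_rows_mult[of ys A R] ys A inv by simp
  then obtain xs N where xs: "length xs = ?k" "set xs \<subseteq> {..<n}" and N: "N \<in> carrier_mat ?r ?r"
    and MN: "gram ?C xs * N = 1\<^sub>m ?r" and NM: "N * gram ?C xs = 1\<^sub>m ?r" and sym: "N\<^sup>T = N"
    and le: "\<And>j. j < n \<Longrightarrow> (?C * N * ?C\<^sup>T) $$ (j, j) \<le> 1"
    using optimal_design[OF C ys(2) _ n, of ?k] ys d by auto
  define S where "S = select_rows ?C xs"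
  have S: "S \<in> carrier_mat ?k ?r" using C xs(1) unfolding S_def by (metis select_rows_carrier)
  \<comment> \<open>The pseudoinverse of \<open>S\<close>, which has full column rank.\<close>
  define K where "K = N * S\<^sup>T"
  have K: "K \<in> carrier_mat ?r ?k" using N S by (simp add: K_def)
  have KS: "K * S = 1\<^sub>m ?r"
    using assoc_mult_mat[of N ?r ?r "S\<^sup>T" ?k S ?r] N S NM by (simp add: K_def gram_def S_def)
  have CT: "?C * ?T = A" using fac assoc_mult_mat[OF A R T] by simp
  have "select_rows A xs = S * ?T"
    using select_rows_mult[of xs ?C ?T] xs C A by (simp add: CT S_def)
  then have rec: "?C * K * select_rows A xs = A"
    using assoc_mult_mat[OF C K, of "S * ?T" d] assoc_mult_mat[OF K S T] S T KS CT by simp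
  have norm: "(\<Sum>i<?k. ((?C * K) $$ (j, i))\<^sup>2) \<le> 1" if j: "j < n" for j
  proof -
    have "(\<Sum>i<?k. ((?C * K) $$ (j, i))\<^sup>2) = ((?C * K) * (?C * K)\<^sup>T) $$ (j, j)"
      using j C K A by (simp add: scalar_prod_def atLeast0LessThan power2_eq_square)
    also have "(?C * K)\<^sup>T = S * N * ?C\<^sup>T"
      using transpose_mult[OF C K] transpose_mult[of N ?r ?r "S\<^sup>T" ?k] N S sym by (simp add: K_def)
    \<comment> \<open>The inner \<open>K * S\<close> cancels, leaving the matrix whose diagonal the
      design bounds.\<close>
    also have "?C * K * (S * N * ?C\<^sup>T) = ?C * (K * S * (N * ?C\<^sup>T))"
    proof -
      have "N * ?C\<^sup>T \<in> carrier_mat ?r n" "S * (N * ?C\<^sup>T) \<in> carrier_mat ?k n"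
        "?C\<^sup>T \<in> carrier_mat ?r n" using N S C by auto
      then show ?thesis
        using assoc_mult_mat[OF C K, of "S * (N * ?C\<^sup>T)" n] assoc_mult_mat[OF K S, of "N * ?C\<^sup>T" n]
          assoc_mult_mat[OF S N, of "?C\<^sup>T" n] by simp
    qed
    also have "\<dots> = ?C * N * ?C\<^sup>T"
      using KS N C assoc_mult_mat[OF C N, of "?C\<^sup>T" n] by simp
    finally show ?thesis using le[OF j] by simp
  qed
  show thesis
    by (rule that[of xs "?C * K" "R * K"])
      (use xs A R K C rec norm in \<open>auto intro!: assoc_mult_mat[OF A R K, symmetric]\<close>)
qed

section \<open>From leverages to the maximum norm\<close>

text \<open>Cauchy-Schwarz against the all-ones vector, proved termwise by expanding the square of
  \<open>?t * \<bar>f i\<bar> - 1\<close>. The empty index set is separate because of the division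
  by \<open>?t\<close>.\<close>

lemma sum_abs_le_sqrt_card:
  fixes f :: "'a \<Rightarrow> real"
  assumes "finite I" and sq: "(\<Sum>i\<in>I. (f i)\<^sup>2) \<le> 1"
  shows "(\<Sum>i\<in>I. \<bar>f i\<bar>) \<le> sqrt (card I)"
proof (cases "I = {}")
  case False
  let ?t = "sqrt (card I)"
  have t: "0 < ?t" "?t * ?t = card I" using False assms by (auto simp: card_gt_0_iff)
  have "\<bar>f i\<bar> \<le> (?t * (f i)\<^sup>2 + 1 / ?t) / 2" for i
  proof -
    have "0 \<le> (?t * \<bar>f i\<bar> - 1)\<^sup>2" by simp
    also have "\<dots> = ?t * (?t * (f i)\<^sup>2 + 1 / ?t - 2 * \<bar>f i\<bar>)"
      using t(1) by (simp add: field_simps power2_eq_square)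
    finally show ?thesis using t(1) by (simp add: zero_le_mult_iff)
  qed
  then have "(\<Sum>i\<in>I. \<bar>f i\<bar>) \<le> (\<Sum>i\<in>I. (?t * (f i)\<^sup>2 + 1 / ?t) / 2)" by (intro sum_mono)
  also have "\<dots> = (?t * (\<Sum>i\<in>I. (f i)\<^sup>2) + card I / ?t) / 2"
    by (simp add: sum_divide_distrib[symmetric] sum.distrib sum_distrib_left)
  also have "\<dots> \<le> (?t * 1 + ?t * ?t / ?t) / 2"
    unfolding t(2) using t(1) sq by (intro divide_right_mono add_right_mono mult_left_mono) auto
  also have "\<dots> = ?t" using t(1) by (simp only: nonzero_mult_div_cancel_right) simp
  finally show ?thesis .
qed simp

lemma abs_le_linf_norm: "i < dim_vec v \<Longrightarrow> \<bar>v $ i\<bar> \<le> linf_norm v"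
  unfolding linf_norm_def by (intro Max_ge) auto

lemma linf_norm_nonneg: "0 \<le> linf_norm v"
  unfolding linf_norm_def by (intro Max_ge) auto

lemma linf_norm_le:
  "0 \<le> c \<Longrightarrow> (\<And>i. i < dim_vec v \<Longrightarrow> \<bar>v $ i\<bar> \<le> c) \<Longrightarrow> linf_norm v \<le> c"
  unfolding linf_norm_def by (subst Max_le_iff) auto

text \<open>\<open>A *\<^sub>v x\<close> is predicted exactly from its own entries at the positions
  read, so the computed vector differs from it by \<open>H\<close> applied to the negated residual
  of \<open>x\<close> there. Rows of \<open>H\<close> have absolute sum at most
  \<open>sqrt k\<close>; the residual of \<open>x\<close> itself adds the 1.\<close>

lemma linf_norm_reconstruction:
  fixes A :: "real mat"
  assumes A: "A \<in> carrier_mat n d" and xs: "length xs = k" "set xs \<subseteq> {..<n}"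
    and H: "H \<in> carrier_mat n k" and L: "L \<in> carrier_mat d k" and AL: "A * L = H"
    and HS: "H * select_rows A xs = A" and norm: "\<And>j. j < n \<Longrightarrow> (\<Sum>i<k. (H $$ (j, i))\<^sup>2) \<le> 1"
    and b: "b \<in> carrier_vec n" and x: "x \<in> carrier_vec d"
  shows "linf_norm (A *\<^sub>v (L *\<^sub>v vec k (\<lambda>i. b $ (xs ! i))) - b)
    \<le> (1 + sqrt k) * linf_norm (A *\<^sub>v x - b)"
proof -
  let ?S = "select_rows A xs" and ?y = "vec k (\<lambda>i. b $ (xs ! i))" and ?e = "A *\<^sub>v x - b"
  have S: "?S \<in> carrier_mat k d" using A xs(1) select_rows_carrier by metis
  have Ax: "A *\<^sub>v x = H *\<^sub>v (?S *\<^sub>v x)" using assoc_mult_mat_vec[OF H S x] HS by simp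
  have AL: "A *\<^sub>v (L *\<^sub>v ?y) = H *\<^sub>v ?y" using assoc_mult_mat_vec[OF A L, of ?y] AL by simp
  have lt: "xs ! i < n" if "i < k" for i using xs that by (metis lessThan_iff nth_mem subsetD)
  show ?thesis
  proof (rule linf_norm_le)
    fix j assume "j < dim_vec (A *\<^sub>v (L *\<^sub>v ?y) - b)"
    then have j: "j < n" using b by simp
    have "(A *\<^sub>v (L *\<^sub>v ?y)) $ j = (\<Sum>i<k. H $$ (j, i) * b $ (xs ! i))"
      unfolding AL using j H by (simp add: scalar_prod_def atLeast0LessThan)
    moreover have "(A *\<^sub>v x) $ j = (\<Sum>i<k. H $$ (j, i) * (A *\<^sub>v x) $ (xs ! i))"
    proof -
      have "(A *\<^sub>v x) $ j = (\<Sum>i<k. H $$ (j, i) * (?S *\<^sub>v x) $ i)"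
      proof -
        have "(A *\<^sub>v x) $ j = row H j \<bullet> (?S *\<^sub>v x)" using j H by (subst Ax) simp
        then show ?thesis using j H S
          by (simp add: scalar_prod_def[of "row H j"] atLeast0LessThan carrier_matD(1)[OF S]
              del: index_mult_mat_vec dim_select_rows)
      qed
      moreover have "(?S *\<^sub>v x) $ i = (A *\<^sub>v x) $ (xs ! i)" if "i < k" for i
        using that lt[OF that] xs(1) A by simp
      ultimately show ?thesis by simp
    qed
    ultimately have "(A *\<^sub>v (L *\<^sub>v ?y)) $ j - (A *\<^sub>v x) $ j
        = (\<Sum>i<k. H $$ (j, i) * (b $ (xs ! i) - (A *\<^sub>v x) $ (xs ! i)))"
      by (simp add: right_diff_distrib sum_subtractf)
    also have "\<bar>\<dots>\<bar> \<le> (\<Sum>i<k. \<bar>H $$ (j, i)\<bar> * linf_norm ?e)"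
    proof (rule order_trans[OF sum_abs sum_mono])
      fix i assume "i \<in> {..<k}"
      then have i: "xs ! i < n" using lt by simp
      have "\<bar>b $ (xs ! i) - (A *\<^sub>v x) $ (xs ! i)\<bar> \<le> linf_norm ?e"
        using abs_le_linf_norm[of "xs ! i" ?e] i A b by (simp add: abs_minus_commute)
      then show "\<bar>H $$ (j, i) * (b $ (xs ! i) - (A *\<^sub>v x) $ (xs ! i))\<bar> \<le> \<bar>H $$ (j, i)\<bar> * linf_norm ?e"
        by (simp add: abs_mult mult_left_mono)
    qed
    also have "\<dots> = (\<Sum>i<k. \<bar>H $$ (j, i)\<bar>) * linf_norm ?e" by (simp add: sum_distrib_right)
    also have "\<dots> \<le> sqrt k * linf_norm ?e"
      using sum_abs_le_sqrt_card[OF _ norm[OF j]] by (intro mult_right_mono linf_norm_nonneg) simp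
    finally have "\<bar>(A *\<^sub>v (L *\<^sub>v ?y)) $ j - (A *\<^sub>v x) $ j\<bar> \<le> sqrt k * linf_norm ?e" .
    moreover have "\<bar>(A *\<^sub>v x) $ j - b $ j\<bar> \<le> linf_norm ?e"
      using abs_le_linf_norm[of j ?e] j A b by simp
    ultimately show "\<bar>(A *\<^sub>v (L *\<^sub>v ?y) - b) $ j\<bar> \<le> (1 + sqrt k) * linf_norm ?e"
      using j b by (simp add: distrib_right)
  qed (simp add: linf_norm_nonneg)
qed

section \<open>The query algorithm\<close>

text \<open>A nonadaptive tree: positions are fixed in advance and the continuation collects the
  values in order.\<close>

primrec read_all :: "nat list \<Rightarrow> (real list \<Rightarrow> real vec) \<Rightarrow> query_alg" where
  "read_all [] f = Output (f [])"
| "read_all (i # is) f = Query i (\<lambda>y. read_all is (\<lambda>ys. f (y # ys)))"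

lemma run_read_all [simp]: "run (read_all is f) b = f (map (($) b) is)"
  by (induction "is" arbitrary: f) auto

lemma reads_read_all [simp]: "reads (read_all is f) b = is"
  by (induction "is" arbitrary: f) auto

text \<open>\<open>t / c\<close> is a lower bound of all residual norms, hence of their
  infimum.\<close>

lemma le_min_linf_residual:
  assumes "0 < c" and "\<And>x. x \<in> carrier_vec (dim_col A) \<Longrightarrow> t \<le> c * linf_norm (A *\<^sub>v x - b)"
  shows "t \<le> c * min_linf_residual A b"
proof -
  have "t / c \<le> min_linf_residual A b"
    unfolding min_linf_residual_def
  proof (rule cINF_greatest)
    show "carrier_vec (dim_col A) \<noteq> ({} :: real vec set)" by (metis empty_iff zero_carrier_vec)
  qed (use assms in \<open>simp add: field_simps\<close>)
  with assms(1) show ?thesis by (simp add: field_simps)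
qed

lemma exists_query_alg:
  fixes A :: "real mat"
  assumes A: "A \<in> carrier_mat n d" and d: "1 \<le> d"
  shows "\<exists>q. \<forall>b\<in>carrier_vec n. set (reads q b) \<subseteq> {..<n} \<and> length (reads q b) \<le> 2 * d \<and>
    run q b \<in> carrier_vec d \<and>
    linf_norm (A *\<^sub>v run q b - b) \<le> (3 * sqrt d) * min_linf_residual A b"
proof (cases "n = 0")
  case True
  \<comment> \<open>Without rows there is nothing to select; the residual is the empty vector, of
    norm 0, so no reads are made.\<close>
  have "linf_norm (A *\<^sub>v 0\<^sub>v d - b) \<le> (3 * sqrt d) * min_linf_residual A b"
    if "b \<in> carrier_vec n" for b
  proof (rule le_min_linf_residual)
    have "linf_norm (A *\<^sub>v 0\<^sub>v d - b) \<le> 0" using that True by (intro linf_norm_le) auto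
    then show "linf_norm (A *\<^sub>v 0\<^sub>v d - b) \<le> 3 * sqrt d * linf_norm (A *\<^sub>v x - b)" for x
      using linf_norm_nonneg[of "A *\<^sub>v x - b"] by (smt (verit) mult_nonneg_nonneg real_sqrt_ge_zero of_nat_0_le_iff)
  qed (use d in simp)
  then show ?thesis by (intro exI[of _ "Output (0\<^sub>v d)"]) auto
next
  case False
  then have n: "0 < n" and "0 < d" using d by auto
  then obtain xs H L where xs: "length xs = 2 * d" "set xs \<subseteq> {..<n}"
    and H: "H \<in> carrier_mat n (2 * d)" and L: "L \<in> carrier_mat d (2 * d)"
    and eqs: "A * L = H" "H * select_rows A xs = A"
    and norm: "\<And>j. j < n \<Longrightarrow> (\<Sum>i<2 * d. (H $$ (j, i))\<^sup>2) \<le> 1"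
    using design_reconstruction[OF A] by metis
  let ?q = "read_all xs (\<lambda>ys. L *\<^sub>v vec_of_list ys)"
  \<comment> \<open>\<open>1 \<le> d\<close> absorbs the summand 1 into \<open>sqrt d\<close>, and
    \<open>sqrt 2 \<le> 2\<close> gives the constant 3.\<close>
  have K: "1 + sqrt (2 * d) \<le> 3 * sqrt d"
  proof -
    have "1 \<le> sqrt d" using d by simp
    moreover have "sqrt (2 * d) \<le> 2 * sqrt d"
      by (rule real_le_lsqrt) (auto simp: power_mult_distrib)
    ultimately show ?thesis by linarith
  qed
  have "linf_norm (A *\<^sub>v run ?q b - b) \<le> (3 * sqrt d) * min_linf_residual A b"
    if b: "b \<in> carrier_vec n" for b
  proof (rule le_min_linf_residual)
    fix x :: "real vec" assume "x \<in> carrier_vec (dim_col A)"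
    then have x: "x \<in> carrier_vec d" using A by simp
    have "vec_of_list (map (($) b) xs) = vec (2 * d) (\<lambda>i. b $ (xs ! i))"
      using xs(1) by (intro eq_vecI) (auto simp: vec_of_list_index)
    then have "linf_norm (A *\<^sub>v run ?q b - b) \<le> (1 + sqrt (2 * d)) * linf_norm (A *\<^sub>v x - b)"
      using linf_norm_reconstruction[OF A xs H L eqs norm b x] by simp
    also have "\<dots> \<le> 3 * sqrt d * linf_norm (A *\<^sub>v x - b)"
      by (intro mult_right_mono K linf_norm_nonneg)
    finally show "linf_norm (A *\<^sub>v run ?q b - b) \<le> 3 * sqrt d * linf_norm (A *\<^sub>v x - b)" .
  qed (use d in simp)
  moreover have "run ?q b \<in> carrier_vec d" for b using L by (intro carrier_vecI) simp
  ultimately show ?thesis using xs by (intro exI[of _ ?q]) (simp del: run_read_all)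
qed

theorem theorem14p2:
  shows "\<exists>C > 0. \<exists>K > 0. \<exists>alg :: real mat \<Rightarrow> query_alg.
    \<forall>n d (A :: real mat) (b :: real vec).
      1 \<le> d \<longrightarrow> A \<in> carrier_mat n d \<longrightarrow> b \<in> carrier_vec n \<longrightarrow>
        set (reads (alg A) b) \<subseteq> {..<n} \<and>
        real (length (reads (alg A) b)) \<le> C * (real d * loglog d) \<and>
        run (alg A) b \<in> carrier_vec d \<and>
        linf_norm (A *\<^sub>v run (alg A) b - b) \<le> (K * sqrt (real d)) * min_linf_residual A b"
proof -
  let ?P = "\<lambda>A q. \<forall>b\<in>carrier_vec (dim_row A). set (reads q b) \<subseteq> {..<dim_row A} \<and>
    length (reads q b) \<le> 2 * dim_col A \<and> run q b \<in> carrier_vec (dim_col A) \<and>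
    linf_norm (A *\<^sub>v run q b - b) \<le> (3 * sqrt (dim_col A)) * min_linf_residual A b"
  \<comment> \<open>The choice depends on \<open>A\<close> alone, whose dimensions supply
    \<open>n\<close> and \<open>d\<close>; \<open>?P\<close> then holds for all \<open>b\<close> at
    once.\<close>
  define alg where "alg A = (SOME q. ?P A q)" for A
  have alg: "?P A (alg A)" if "1 \<le> dim_col A" for A
    unfolding alg_def by (rule someI_ex) (use exists_query_alg[of A] that in auto)
  \<comment> \<open>\<open>loglog d\<close> is at least 1, so the linear count \<open>2 * d\<close>
    lies within the claimed bound.\<close>
  have count: "real m \<le> 2 * (real d * loglog d)" if "m \<le> 2 * d" for m d
  proof -
    have "real m \<le> 2 * (real d * 1)" using that by simp
    also have "\<dots> \<le> 2 * (real d * loglog d)"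
      by (intro mult_left_mono) (auto simp: loglog_def)
    finally show ?thesis .
  qed
  show ?thesis
  proof (rule exI[of _ 2], intro conjI, simp, rule exI[of _ 3], intro conjI, simp,
      rule exI[of _ alg], intro allI impI conjI)
    fix n d and A :: "real mat" and b :: "real vec"
    assume d: "1 \<le> d" and A: "A \<in> carrier_mat n d" and "b \<in> carrier_vec n"
    then have dims: "dim_row A = n" "dim_col A = d" and b: "b \<in> carrier_vec (dim_row A)" by auto
    have "?P A (alg A)" using alg[of A] d dims by simp
    from this(1) b have *: "set (reads (alg A) b) \<subseteq> {..<dim_row A} \<and>
      length (reads (alg A) b) \<le> 2 * dim_col A \<and> run (alg A) b \<in> carrier_vec (dim_col A) \<and>
      linf_norm (A *\<^sub>v run (alg A) b - b) \<le> (3 * sqrt (dim_col A)) * min_linf_residual A b"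
      by (rule bspec)
    show "set (reads (alg A) b) \<subseteq> {..<n}" "run (alg A) b \<in> carrier_vec d"
      "linf_norm (A *\<^sub>v run (alg A) b - b) \<le> (3 * sqrt (real d)) * min_linf_residual A b"
      "real (length (reads (alg A) b)) \<le> 2 * (real d * loglog d)"
      using * count by (simp_all add: dims)
  qed
qed

end
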